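(* Let $(\mathcal{C},d_{\mathcal{C}})$ be a Hilbert geometry, $\mathcal{C}\subset\mathbb{R}^n$. Then $(\mathcal{C},d_{\mathcal{C}})$ is quasi-isometric to any of its discretisations $\mathbf{G}$ (endowed with the graph distance), and thus any two of its discretisations are quasi-isometric.
   Context: A Hilbert geometry $(\mathcal{C},d_{\mathcal{C}})$ is a nonempty bounded open convex set $\mathcal{C}\subset\mathbb{R}^n$ with the Hilbert distance: for distinct $p,q\in\mathcal{C}$, the line through $p,q$ meets $\partial\mathcal{C}$ at $a,b$, in the order $a,p,q,b$, and $d_{\mathcal{C}}(p,q)=\frac12\ln\left(\frac{\|q-a\|}{\|p-a\|}\cdot\frac{\|p-b\|}{\|q-b\|}\right)$ with $\|\cdot\|$ the Euclidean norm; $d_{\mathcal{C}}(p,p)=0$. $B(x,r)$ denotes the open ball for $d_{\mathcal{C}}$. A subset $\mathcal{G}\subset\mathcal{C}$ is $\varepsilon$-separated ($\varepsilon>0$) if any two distinct points of $\mathcal{G}$ are at $d_{\mathcal{C}}$-distance at least $\varepsilon$. A discretisation of $\mathcal{C}$ is a graph $\mathbf{G}$ determined by an $\varepsilon$-separated subset $\mathcal{G}$ (for some $\varepsilon>0$) for which there is $\rho>0$ with $\mathcal{C}=\bigcup_{\xi\in\mathcal{G}}B(\xi,\rho)$; its vertex set is $\mathcal{G}$ and the set of neighbours of $\xi\in\mathcal{G}$ is $N(\xi)=(\mathcal{G}\cap B(\xi,3\rho))\setminus\{\xi\}$. The graph $\mathbf{G}$ is connected, and it is endowed with its graph distance $d_{\mathbf{G}}$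 (minimal number of edges in a path). *)

theory Defs
  imports "HOL-Analysis.Analysis"
begin

definition hilbert_geometry :: "'a::euclidean_space set \<Rightarrow> bool" where
  "hilbert_geometry C \<longleftrightarrow> C \<noteq> {} \<and> bounded C \<and> open C \<and> convex C"

(* The point where the ray from p through q leaves C; on the line through p and q the
   order is p, q, exit_point C p q. *)
definition exit_point :: "'a::euclidean_space set \<Rightarrow> 'a \<Rightarrow> 'a \<Rightarrow> 'a" where
  "exit_point C p q = (THE b. b \<in> frontier C \<and> q \<in> open_segment p b)"

lemma exit_point_ex1:
  fixes C :: "'a::euclidean_space set"
  assumes "hilbert_geometry C" "p \<in> C" "q \<in> C" "p \<noteq> q"
  shows "\<exists>!b. b \<in> frontier C \<and> q \<in> open_segment p b"
proof -
  have C: "bounded C" "open C" "convex C" "interior C = C"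
    using assms(1) by (auto simp: hilbert_geometry_def interior_open)
  obtain d where d: "0 < d" "q + d *\<^sub>R (q - p) \<in> frontier C"
    using ray_to_frontier[of C q "q - p"] C assms
    by (metis eq_iff_diff_eq_0)
  have seg: "q \<in> open_segment p (q + d *\<^sub>R (q - p))"
    unfolding in_segment
  proof (intro conjI exI)
    show "p \<noteq> q + d *\<^sub>R (q - p)"
    proof
      assume "p = q + d *\<^sub>R (q - p)"
      then have "(1 + d) *\<^sub>R (q - p) = 0" by (simp add: algebra_simps)
      then show False using d assms(4) by simp
    qed
    show "0 < 1 / (1 + d)" "1 / (1 + d) < 1" using d by auto
    have "q - p = (1 / (1 + d)) *\<^sub>R (1 + d) *\<^sub>R (q - p)" using d by simp
    also have "(1 + d) *\<^sub>R (q - p) = q + d *\<^sub>R (q - p) - p" by (simp add: algebra_simps)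
    finally have "q = p + (1 / (1 + d)) *\<^sub>R (q + d *\<^sub>R (q - p) - p)"
      by (metis add.commute diff_add_cancel)
    then show "q = (1 - 1 / (1 + d)) *\<^sub>R p + (1 / (1 + d)) *\<^sub>R (q + d *\<^sub>R (q - p))"
      by (simp add: algebra_simps)
  qed
  have form: "\<exists>s>1. b = p + s *\<^sub>R (q - p)" if "q \<in> open_segment p b" for b
  proof -
    from that obtain u where u: "0 < u" "u < 1" "q = (1 - u) *\<^sub>R p + u *\<^sub>R b"
      by (auto simp: in_segment)
    then have "q - p = u *\<^sub>R (b - p)" by (simp add: algebra_simps)
    then have "b = p + (1 / u) *\<^sub>R (q - p)" using u(1) by simp
    then show ?thesis using u by (intro exI[of _ "1 / u"]) auto
  qed
  have no: False
    if "1 < s" "s < t" "p + s *\<^sub>R (q - p) \<in> frontier C" "p + t *\<^sub>R (q - p) \<in> frontier C" for s t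
  proof -
    have "p + s *\<^sub>R (q - p) = (1 - s / t) *\<^sub>R p + (s / t) *\<^sub>R (p + t *\<^sub>R (q - p))"
      using that by (simp add: algebra_simps)
    moreover have "p \<noteq> p + t *\<^sub>R (q - p)" "0 < s / t" "s / t < 1"
      using that assms(4) by auto
    ultimately have "p + s *\<^sub>R (q - p) \<in> open_segment p (p + t *\<^sub>R (q - p))"
      unfolding in_segment by blast
    moreover have "open_segment p (p + t *\<^sub>R (q - p)) \<subseteq> interior C"
      using in_interior_closure_convex_segment[of C p "p + t *\<^sub>R (q - p)"] that C assms
      by (auto simp: frontier_def)
    ultimately show False using that(3) by (auto simp: frontier_def)
  qed
  show ?thesis
  proof (intro ex1I conjI)
    show "q + d *\<^sub>R (q - p) \<in> frontier C" by (rule d)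
    show "q \<in> open_segment p (q + d *\<^sub>R (q - p))" by (rule seg)
    fix b assume b: "b \<in> frontier C \<and> q \<in> open_segment p b"
    obtain s where s: "s > 1" "b = p + s *\<^sub>R (q - p)" using form b by blast
    obtain t where t: "t > 1" "q + d *\<^sub>R (q - p) = p + t *\<^sub>R (q - p)" using form[OF seg] by blast
    show "b = q + d *\<^sub>R (q - p)"
      using no[of s t] no[of t s] s t b d(2) by (metis linorder_neqE_linordered_idom)
  qed
qed

definition hilbert_dist :: "'a::euclidean_space set \<Rightarrow> 'a \<Rightarrow> 'a \<Rightarrow> real" where
  "hilbert_dist C p q =
     (if p = q then 0
      else let a = exit_point C q p; b = exit_point C p q
           in 1 / 2 * ln (norm (q - a) / norm (p - a) * (norm (p - b) / norm (q - b))))"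

definition hilbert_ball :: "'a::euclidean_space set \<Rightarrow> 'a \<Rightarrow> real \<Rightarrow> 'a set" where
  "hilbert_ball C x r = {y \<in> C. hilbert_dist C x y < r}"

definition separated_in :: "'a::euclidean_space set \<Rightarrow> real \<Rightarrow> 'a set \<Rightarrow> bool" where
  "separated_in C \<epsilon> V \<longleftrightarrow>
     V \<subseteq> C \<and> (\<forall>\<xi>\<in>V. \<forall>\<eta>\<in>V. \<xi> \<noteq> \<eta> \<longrightarrow> \<epsilon> \<le> hilbert_dist C \<xi> \<eta>)"

definition nbhs :: "'a::euclidean_space set \<Rightarrow> 'a set \<Rightarrow> real \<Rightarrow> 'a \<Rightarrow> 'a set" where
  "nbhs C V \<rho> \<xi> = (V \<inter> hilbert_ball C \<xi> (3 * \<rho>)) - {\<xi>}"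

(* A graph is given by its vertex set V and its adjacency relation E. *)
definition discretisation :: "'a::euclidean_space set \<Rightarrow> 'a set \<Rightarrow> ('a \<times> 'a) set \<Rightarrow> bool" where
  "discretisation C V E \<longleftrightarrow>
     (\<exists>\<epsilon>>0. \<exists>\<rho>>0. separated_in C \<epsilon> V \<and> C = (\<Union>\<xi>\<in>V. hilbert_ball C \<xi> \<rho>) \<and>
        E = (SIGMA \<xi>:V. nbhs C V \<rho> \<xi>))"

(* (x, y) is in E ^^ k iff there is an edge path with k edges from x to y. The value is
   only meaningful for x, y in the same component; discretisations are connected. *)
definition graph_dist :: "('a \<times> 'a) set \<Rightarrow> 'a \<Rightarrow> 'a \<Rightarrow> real" where
  "graph_dist E x y = real (LEAST k. (x, y) \<in> E ^^ k)"

definition quasi_isometric ::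
  "'a set \<Rightarrow> ('a \<Rightarrow> 'a \<Rightarrow> real) \<Rightarrow> 'b set \<Rightarrow> ('b \<Rightarrow> 'b \<Rightarrow> real) \<Rightarrow> bool" where
  "quasi_isometric X dX Y dY \<longleftrightarrow>
     (\<exists>f \<in> X \<rightarrow> Y. \<exists>A\<ge>1. \<exists>B\<ge>0.
        (\<forall>x\<in>X. \<forall>x'\<in>X. 1 / A * dX x x' - B \<le> dY (f x) (f x') \<and> dY (f x) (f x') \<le> A * dX x x' + B) \<and>
        (\<forall>y\<in>Y. \<exists>x\<in>X. dY y (f x) \<le> B))"

end

theory Submission imports Defs begin

text \<open>The Hilbert distance is a metric for which straight segments are geodesics. A path with
  \<open>k\<close> edges moves by at most \<open>3 \<rho> k\<close>; conversely, cutting the segment between two vertices into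
  pieces shorter than \<open>\<rho>\<close> and replacing each cutting point by a vertex within \<open>\<rho>\<close> gives a path
  with at most \<open>d / \<rho> + 1\<close> edges. So the graph distance and the Hilbert distance are comparable
  on the vertex set, which is coarsely dense, and nearest-vertex maps are quasi-isometries.\<close>

section \<open>The Funk distance\<close>

text \<open>The asymmetric half of the Hilbert distance: only the boundary point beyond
  \<open>q\<close> enters. Once the Hilbert distance is written as the mean of the two orientations,
  the triangle inequality can be proved for each orientation alone.\<close>

definition funk :: "'a::euclidean_space set \<Rightarrow> 'a \<Rightarrow> 'a \<Rightarrow> real" where
  "funk C p q =
     (if p = q then 0
      else ln (norm (p - exit_point C p q) / norm (q - exit_point C p q)))"

text \<open>The factor \<open>norm u\<close> cancels in the ratio, so only the parameters remain.
  Replacing \<open>u\<close> by \<open>- u\<close> gives the opposite orientation on the same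
  line.\<close>

lemma funk_on_line:
  fixes C :: "'a::euclidean_space set"
  assumes C: "hilbert_geometry C" and inC: "p + x *\<^sub>R u \<in> C" "p + y *\<^sub>R u \<in> C"
    and u: "u \<noteq> 0" and xy: "x \<le> y" "y < s" and s: "p + s *\<^sub>R u \<in> frontier C"
  shows "funk C (p + x *\<^sub>R u) (p + y *\<^sub>R u) = ln ((s - x) / (s - y))"
proof (cases "x = y")
  case True
  then show ?thesis using xy by (simp add: funk_def)
next
  case False
  with xy have xy': "x < y" by simp
  let ?p = "p + x *\<^sub>R u" and ?q = "p + y *\<^sub>R u" and ?b = "p + s *\<^sub>R u"
  have ne: "?p \<noteq> ?q" using False u by simp
  \<comment> \<open>The weight of \<open>?b\<close> when \<open>?q\<close> is written as a convex
    combination of \<open>?p\<close> and \<open>?b\<close>.\<close>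
  define k where "k = (y - x) / (s - x)"
  have k: "0 < k" "k < 1" using xy xy' by (auto simp: k_def)
  have "k * (s - x) = y - x" using xy xy' by (simp add: k_def)
  then have yk: "y = (1 - k) * x + k * s" by (simp add: algebra_simps)
  have "?q = (1 - k) *\<^sub>R ?p + k *\<^sub>R ?b"
    by (subst yk) (simp add: algebra_simps)
  moreover have "?p \<noteq> ?b" using xy xy' u by simp
  ultimately have "?q \<in> open_segment ?p ?b"
    unfolding in_segment using k by blast
  then have "exit_point C ?p ?q = ?b"
    unfolding exit_point_def
    using the1_equality[OF exit_point_ex1[OF C inC ne]] s by blast
  moreover have "norm (?p - ?b) = (s - x) * norm u"
  proof -
    have "?p - ?b = (x - s) *\<^sub>R u" by (simp add: algebra_simps)
    then show ?thesis using xy by simp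
  qed
  moreover have "norm (?q - ?b) = (s - y) * norm u"
  proof -
    have "?q - ?b = (y - s) *\<^sub>R u" by (simp add: algebra_simps)
    then show ?thesis using xy by simp
  qed
  ultimately show ?thesis using ne u by (simp add: funk_def)
qed

lemma ray_meets_frontier:
  fixes C :: "'a::euclidean_space set"
  assumes "hilbert_geometry C" "p \<in> C" "q \<in> C" "p \<noteq> q"
  obtains s where "s > 1" "p + s *\<^sub>R (q - p) \<in> frontier C"
proof -
  obtain d where d: "0 < d" "q + d *\<^sub>R (q - p) \<in> frontier C"
    using ray_to_frontier[of C q "q - p"] assms
    by (metis eq_iff_diff_eq_0 hilbert_geometry_def interior_open)
  show ?thesis
    by (rule that[of "1 + d"]) (use d in \<open>auto simp: algebra_simps\<close>)
qed

lemma exp_funk: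
  fixes C :: "'a::euclidean_space set"
  assumes "hilbert_geometry C" "p \<in> C" "q \<in> C" "p \<noteq> q"
  obtains s where "s > 1" "p + s *\<^sub>R (q - p) \<in> frontier C" "exp (funk C p q) = s / (s - 1)"
proof -
  obtain s where s: "s > 1" "p + s *\<^sub>R (q - p) \<in> frontier C"
    using ray_meets_frontier assms by blast
  have "funk C p q = ln (s / (s - 1))"
    using funk_on_line[of C p 0 "q - p" 1 s] assms s by simp
  then show ?thesis using that s by simp
qed

text \<open>In terms of the cone over \<open>C\<close>, \<open>exp (funk C p q)\<close> is the least \<open>m\<close> for which
  \<open>m (q, 1) - (p, 1)\<close> lies in the closed cone; the triangle inequality is then the
  transitivity of the order that the cone defines.\<close>

lemma exp_funk_cone:
  fixes C :: "'a::euclidean_space set"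
  assumes "hilbert_geometry C" "p \<in> C" "q \<in> C"
  obtains c where "1 \<le> exp (funk C p q)" "c \<in> closure C"
    "exp (funk C p q) *\<^sub>R q - p = (exp (funk C p q) - 1) *\<^sub>R c"
proof (cases "p = q")
  case True
  then show ?thesis using that[of p] assms closure_subset[of C] by (auto simp: funk_def)
next
  case False
  obtain s where s: "s > 1" "p + s *\<^sub>R (q - p) \<in> frontier C" "exp (funk C p q) = s / (s - 1)"
    using exp_funk[OF assms False] .
  have "s / (s - 1) - 1 = 1 / (s - 1)" using s(1) by (simp add: field_simps)
  moreover have "(s / (s - 1)) *\<^sub>R q - p = (1 / (s - 1)) *\<^sub>R (p + s *\<^sub>R (q - p))"
  proof -
    define k where "k = 1 / (s - 1)"
    have k: "s / (s - 1) = k + 1" "k * s = k + 1" using s(1) by (auto simp: k_def field_simps)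
    have "k *\<^sub>R (p + s *\<^sub>R (q - p)) = k *\<^sub>R p + (k * s) *\<^sub>R (q - p)"
      by (simp add: scaleR_right_distrib)
    also have "\<dots> = (k + 1) *\<^sub>R q - p" unfolding k(2) by (simp add: algebra_simps)
    finally show ?thesis using k(1) by (simp add: k_def)
  qed
  \<comment> \<open>The witness for \<open>c\<close> is the boundary point on the ray from
    \<open>p\<close> through \<open>q\<close>.\<close>
  ultimately show ?thesis
    using that[of "p + s *\<^sub>R (q - p)"] s by (auto simp: frontier_def)
qed

text \<open>This is the minimality. The relation puts \<open>c\<close> on the ray from
  \<open>p\<close> through \<open>q\<close> at parameter \<open>m / (m - 1)\<close>; no point of the
  closure lies beyond the exit parameter, and a bound on this parameter from above bounds
  \<open>m\<close> from below.\<close>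

lemma exp_funk_le:
  fixes C :: "'a::euclidean_space set"
  assumes C: "hilbert_geometry C" "p \<in> C" "q \<in> C"
    and m: "1 \<le> m" and c: "c \<in> closure C" "m *\<^sub>R q - p = (m - 1) *\<^sub>R c"
  shows "exp (funk C p q) \<le> m"
proof (cases "p = q")
  case True
  then show ?thesis using m by (simp add: funk_def)
next
  case False
  obtain s where s: "s > 1" "p + s *\<^sub>R (q - p) \<in> frontier C" "exp (funk C p q) = s / (s - 1)"
    using exp_funk[OF C False] .
  have m1: "1 < m" using m c False by (cases "m = 1") auto
  define t where "t = m / (m - 1)"
  have t: "t * (m - 1) = m" "1 < t" using m1 by (auto simp: t_def)
  have "c = (1 / (m - 1)) *\<^sub>R ((m - 1) *\<^sub>R c)" using m1 by simp
  also have "\<dots> = (1 / (m - 1)) *\<^sub>R ((m - 1) *\<^sub>R p + m *\<^sub>R (q - p))"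
    unfolding c(2)[symmetric] by (simp add: algebra_simps)
  also have "\<dots> = p + t *\<^sub>R (q - p)"
    using m1 by (simp add: t_def scaleR_right_distrib)
  finally have ct: "c = p + t *\<^sub>R (q - p)" .
  \<comment> \<open>Otherwise the boundary point at parameter \<open>s\<close> would lie strictly
    between the interior point \<open>p\<close> and the closure point \<open>c\<close>, hence in the
    interior.\<close>
  have "t \<le> s"
  proof (rule ccontr)
    assume "\<not> t \<le> s"
    then have ts: "s < t" by simp
    have "p + s *\<^sub>R (q - p) = (1 - s / t) *\<^sub>R p + (s / t) *\<^sub>R c"
      using ts s(1) by (simp add: ct algebra_simps)
    moreover have "p \<noteq> c" "0 < s / t" "s / t < 1"
      using ts s(1) False by (auto simp: ct)
    ultimately have "p + s *\<^sub>R (q - p) \<in> open_segment p c"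
      unfolding in_segment by blast
    moreover have "open_segment p c \<subseteq> interior C"
      using in_interior_closure_convex_segment[of C p c] C c(1)
      by (auto simp: hilbert_geometry_def interior_open)
    ultimately show False using s(2) by (auto simp: frontier_def)
  qed
  \<comment> \<open>The map x / (x - 1) is decreasing for x > 1.\<close>
  then have "s / (s - 1) \<le> t / (t - 1)"
    using t(2) by (simp add: field_simps)
  also have "t / (t - 1) = m" using t m1 by (simp add: field_simps)
  finally show ?thesis using s(3) by simp
qed

lemma funk_nonneg:
  assumes "hilbert_geometry C" "p \<in> C" "q \<in> C"
  shows "0 \<le> funk C p q"
  using exp_funk_cone[OF assms] by (metis one_le_exp_iff)

lemma funk_triangle:
  fixes C :: "'a::euclidean_space set"
  assumes C: "hilbert_geometry C" and inC: "p \<in> C" "q \<in> C" "r \<in> C"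
  shows "funk C p r \<le> funk C p q + funk C q r"
proof -
  define l where "l = exp (funk C p q)"
  define m where "m = exp (funk C q r)"
  obtain b where b: "1 \<le> l" "b \<in> closure C" "l *\<^sub>R q - p = (l - 1) *\<^sub>R b"
    unfolding l_def using exp_funk_cone[OF C inC(1,2)] .
  obtain c where c: "1 \<le> m" "c \<in> closure C" "m *\<^sub>R r - q = (m - 1) *\<^sub>R c"
    unfolding m_def using exp_funk_cone[OF C inC(2,3)] .
  have lm: "1 \<le> l * m" using b(1) c(1) mult_mono[of 1 l 1 m] by simp
  \<comment> \<open>Scale the second cone relation by \<open>l\<close> and add the first, so that
    \<open>q\<close> cancels.\<close>
  have eq: "(l * m) *\<^sub>R r - p = (l * (m - 1)) *\<^sub>R c + (l - 1) *\<^sub>R b"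
  proof -
    have "(l * m) *\<^sub>R r - p = l *\<^sub>R (m *\<^sub>R r - q) + (l *\<^sub>R q - p)"
      by (simp add: algebra_simps)
    then show ?thesis using b(3) c(3) by simp
  qed
  have "\<exists>e\<in>closure C. (l * m) *\<^sub>R r - p = (l * m - 1) *\<^sub>R e"
  proof (cases "l * m = 1")
    case True
    then have "l = 1" "m = 1"
      using b(1) c(1) mult_mono[of l l 1 m] mult_mono[of 1 l m m] by auto
    then show ?thesis using eq b(2) by auto
  next
    case False
    let ?n = "l * m - 1"
    have n: "0 < ?n" using False lm by simp
    \<comment> \<open>The coefficients of \<open>c\<close> and \<open>b\<close> in \<open>eq\<close>
      add up to \<open>?n\<close>; dividing by it leaves a convex combination in which
      \<open>b\<close> has weight \<open>w\<close>.\<close>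
    define w where "w = (l - 1) / ?n"
    have w: "w * ?n = l - 1" using n by (simp add: w_def)
    have w0: "0 \<le> w" using b(1) n by (simp add: w_def)
    have "l * 1 \<le> l * m" using b(1) c(1) by (intro mult_left_mono) auto
    then have w1: "w \<le> 1" using n by (simp add: w_def)
    have w': "(1 - w) * ?n = l * (m - 1)"
      using w by (simp add: algebra_simps)
    have "(1 - w) *\<^sub>R c + w *\<^sub>R b \<in> closure C"
      using convex_closure[of C] C b(2) c(2) w0 w1
      by (auto simp: hilbert_geometry_def convex_alt)
    moreover have "?n *\<^sub>R ((1 - w) *\<^sub>R c + w *\<^sub>R b) = (l * (m - 1)) *\<^sub>R c + (l - 1) *\<^sub>R b"
      using w w' by (simp add: scaleR_right_distrib mult.commute)
    ultimately show ?thesis using eq by metis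
  qed
  then have "exp (funk C p r) \<le> l * m"
    using exp_funk_le[OF C inC(1,3) lm] by blast
  also have "l * m = exp (funk C p q + funk C q r)"
    by (simp add: l_def m_def exp_add)
  finally show ?thesis by simp
qed

section \<open>The Hilbert distance as a geodesic metric\<close>

lemma hilbert_dist_funk:
  fixes C :: "'a::euclidean_space set"
  assumes C: "hilbert_geometry C" and inC: "p \<in> C" "q \<in> C"
  shows "hilbert_dist C p q = (funk C p q + funk C q p) / 2"
proof (cases "p = q")
  case True
  then show ?thesis by (simp add: hilbert_dist_def funk_def)
next
  case False
  \<comment> \<open>Exit points lie on the frontier of an open set, so outside \<open>C\<close>. All
    four norms are thus positive, and the logarithm of the cross-ratio splits.\<close>
  have notin: "norm (x - exit_point C y z) > 0" if "x \<in> C" "y \<in> C" "z \<in> C" "y \<noteq> z" for x y z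
  proof -
    have "exit_point C y z \<in> frontier C"
      unfolding exit_point_def using theI'[OF exit_point_ex1[OF C that(2-4)]] by blast
    then have "exit_point C y z \<notin> C"
      using C by (auto simp: hilbert_geometry_def frontier_def interior_open)
    then show ?thesis using that(1) by auto
  qed
  show ?thesis
    using False notin[OF inC(1) inC False] notin[OF inC(2) inC False]
      notin[OF inC(1) inC(2,1)] notin[OF inC(2) inC(2,1)]
    by (simp add: hilbert_dist_def funk_def Let_def ln_mult ln_div)
qed

lemma hilbert_dist_self [simp]: "hilbert_dist C p p = 0"
  by (simp add: hilbert_dist_def)

lemma hilbert_dist_nonneg:
  assumes "hilbert_geometry C" "p \<in> C" "q \<in> C"
  shows "0 \<le> hilbert_dist C p q"
  using assms funk_nonneg[of C p q] funk_nonneg[of C q p] by (simp add: hilbert_dist_funk)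

lemma hilbert_dist_sym:
  assumes "hilbert_geometry C" "p \<in> C" "q \<in> C"
  shows "hilbert_dist C p q = hilbert_dist C q p"
  using assms by (simp add: hilbert_dist_funk)

lemma hilbert_dist_triangle:
  assumes "hilbert_geometry C" "p \<in> C" "q \<in> C" "r \<in> C"
  shows "hilbert_dist C p r \<le> hilbert_dist C p q + hilbert_dist C q r"
  using assms funk_triangle[of C p q r] funk_triangle[of C r q p]
  by (simp add: hilbert_dist_funk add_divide_distrib)

text \<open>Along the segment from \<open>p\<close> to \<open>q\<close> the distance is the
  increment of one continuous function of the parameter. Hence it is additive, and the intermediate
  value theorem finds the point at distance \<open>r\<close>.\<close>

lemma hilbert_dist_between:
  fixes C :: "'a::euclidean_space set"
  assumes C: "hilbert_geometry C" and inC: "p \<in> C" "q \<in> C"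
    and r: "0 \<le> r" "r \<le> hilbert_dist C p q"
  obtains z where "z \<in> C" "hilbert_dist C p z = r"
    "hilbert_dist C z q = hilbert_dist C p q - r"
proof (cases "p = q")
  case True
  then show ?thesis using that[of p] r inC by simp
next
  case False
  define u where "u = q - p"
  have u: "u \<noteq> 0" using False by (simp add: u_def)
  obtain s where s: "s > 1" "p + s *\<^sub>R u \<in> frontier C"
    using ray_meets_frontier[OF C inC False] unfolding u_def .
  obtain t where t: "t > 1" "q + t *\<^sub>R (p - q) \<in> frontier C"
    using ray_meets_frontier[OF C inC(2,1)] False by metis
  \<comment> \<open>The line leaves \<open>C\<close> backwards at parameter \<open>- a\<close>,
    counted from \<open>p\<close> in units of \<open>u\<close>.\<close>
  define a where "a = t - 1"
  have a: "a > 0" "p + a *\<^sub>R (- u) \<in> frontier C"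
    using t by (auto simp: a_def u_def algebra_simps)
  have onC: "p + x *\<^sub>R u \<in> C" if "0 \<le> x" "x \<le> 1" for x
  proof -
    have "(1 - x) *\<^sub>R p + x *\<^sub>R q \<in> C"
      using C inC that by (auto simp: hilbert_geometry_def convex_alt)
    then show ?thesis by (simp add: u_def algebra_simps)
  qed
  define h where "h x = (ln (x + a) - ln (s - x)) / 2" for x
  have dist: "hilbert_dist C (p + x *\<^sub>R u) (p + y *\<^sub>R u) = h y - h x"
    if "0 \<le> x" "x \<le> y" "y \<le> 1" for x y
  proof -
    have "funk C (p + x *\<^sub>R u) (p + y *\<^sub>R u) = ln ((s - x) / (s - y))"
      using funk_on_line[OF C _ _ u that(2) _ s(2)] onC that s(1) by simp
    \<comment> \<open>Run the line in direction \<open>- u\<close>: the two parameters become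
      \<open>- y\<close> and \<open>- x\<close>, and the boundary point has parameter
      \<open>a\<close>.\<close>
    moreover have "funk C (p + y *\<^sub>R u) (p + x *\<^sub>R u) = ln ((a + y) / (a + x))"
      using funk_on_line[OF C _ _ _ _ _ a(2), of "- y" "- x"] onC that a(1) u by simp
    ultimately show ?thesis
      using hilbert_dist_funk[OF C, of "p + x *\<^sub>R u" "p + y *\<^sub>R u"] onC that s(1) a(1)
      by (simp add: h_def ln_div field_simps)
  qed
  have pq: "hilbert_dist C p q = h 1 - h 0"
    using dist[of 0 1] by (simp add: u_def)
  have "continuous_on {0..1} h"
    unfolding h_def using s(1) a(1) by (intro continuous_intros) auto
  then obtain x where x: "0 \<le> x" "x \<le> 1" "h x = h 0 + r"
    using IVT'[of h 0 "h 0 + r" 1] r pq by auto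
  show ?thesis
    using that[of "p + x *\<^sub>R u"] onC x dist[of 0 x] dist[of x 1] pq by (simp add: u_def)
qed

section \<open>Discretisations\<close>

lemma edge_path_hilbert_dist_le:
  assumes C: "hilbert_geometry C" and V: "V \<subseteq> C"
    and E: "E = (SIGMA \<xi>:V. nbhs C V \<rho> \<xi>)"
  shows "(\<xi>, \<eta>) \<in> E ^^ k \<Longrightarrow> \<xi> \<in> V \<Longrightarrow> \<eta> \<in> V \<and> hilbert_dist C \<xi> \<eta> \<le> 3 * \<rho> * real k"
proof (induction k arbitrary: \<eta>)
  case 0
  then show ?case by simp
next
  case (Suc k)
  then obtain \<zeta> where z: "(\<xi>, \<zeta>) \<in> E ^^ k" "(\<zeta>, \<eta>) \<in> E" by auto
  from z(2) have e: "\<zeta> \<in> V" "\<eta> \<in> V" "hilbert_dist C \<zeta> \<eta> \<le> 3 * \<rho>"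
    by (auto simp: E nbhs_def hilbert_ball_def)
  have "hilbert_dist C \<xi> \<eta> \<le> hilbert_dist C \<xi> \<zeta> + hilbert_dist C \<zeta> \<eta>"
    using hilbert_dist_triangle[OF C] V e Suc.prems by blast
  then show ?case using e Suc.IH[OF z(1) Suc.prems(2)] by (simp add: algebra_simps)
qed

text \<open>The end points \<open>x\<close>, \<open>y\<close> are only required to be within
  \<open>\<rho>\<close> of the vertices, so that the induction can advance \<open>x\<close> to the
  next cutting point and \<open>\<xi>\<close> to a vertex near it. The length is at most
  \<open>n\<close>, not equal to it, because successive cutting points may share a vertex.\<close>

lemma edge_path_exists:
  fixes C :: "'a::euclidean_space set"
  assumes C: "hilbert_geometry C" and V: "V \<subseteq> C"
    and cover: "C \<subseteq> (\<Union>\<xi>\<in>V. hilbert_ball C \<xi> \<rho>)"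
    and E: "E = (SIGMA \<xi>:V. nbhs C V \<rho> \<xi>)"
  shows "x \<in> hilbert_ball C \<xi> \<rho> \<Longrightarrow> y \<in> hilbert_ball C \<eta> \<rho> \<Longrightarrow> \<xi> \<in> V \<Longrightarrow> \<eta> \<in> V \<Longrightarrow>
    hilbert_dist C x y < real n * \<rho> \<Longrightarrow> \<exists>k\<le>n. (\<xi>, \<eta>) \<in> E ^^ k"
proof (induction n arbitrary: x \<xi>)
  case 0
  then show ?case
    using hilbert_dist_nonneg[OF C, of x y] by (simp add: hilbert_ball_def)
next
  case (Suc n)
  \<comment> \<open>Three distances below \<open>\<rho>\<close>, from vertex to point to point to
    vertex, add up to less than the radius \<open>3 * \<rho>\<close> that defines
    neighbours.\<close>
  have step: "\<exists>k\<le>1. (\<xi>, \<zeta>) \<in> E ^^ k"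
    if "\<zeta> \<in> V" "z \<in> hilbert_ball C \<zeta> \<rho>" "hilbert_dist C x z < \<rho>" for \<zeta> z
  proof (cases "\<xi> = \<zeta>")
    case True
    then show ?thesis by (intro exI[of _ 0]) auto
  next
    case False
    have inC: "\<xi> \<in> C" "\<zeta> \<in> C" "x \<in> C" "z \<in> C"
      using V that Suc.prems by (auto simp: hilbert_ball_def)
    have "hilbert_dist C \<xi> \<zeta> \<le> hilbert_dist C \<xi> x + hilbert_dist C x z + hilbert_dist C \<zeta> z"
      using hilbert_dist_triangle[OF C, of \<xi> x \<zeta>] hilbert_dist_triangle[OF C, of x z \<zeta>]
        hilbert_dist_sym[OF C, of z \<zeta>] inC by simp
    also have "\<dots> < 3 * \<rho>"
      using that Suc.prems(1) by (simp add: hilbert_ball_def)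
    finally have "(\<xi>, \<zeta>) \<in> E"
      using False that Suc.prems(3) inC by (simp add: E nbhs_def hilbert_ball_def)
    then show ?thesis by (intro exI[of _ 1]) auto
  qed
  \<comment> \<open>For \<open>n = 0\<close> the induction hypothesis would ask for a negative
    distance, so one step leads directly to \<open>\<eta>\<close>.\<close>
  show ?case
  proof (cases "n = 0")
    case True
    then show ?thesis using step[of \<eta> y] Suc.prems by auto
  next
    case False
    have inC: "x \<in> C" "y \<in> C" using Suc.prems by (auto simp: hilbert_ball_def)
    define D where "D = hilbert_dist C x y"
    \<comment> \<open>The length of each of \<open>Suc n\<close> equal pieces: the first is shorter
      than \<open>\<rho>\<close>, and the other \<open>n\<close> together are shorter than
      \<open>real n * \<rho>\<close>.\<close>
    define r where "r = D / real (Suc n)"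
    have D: "0 \<le> D" "D < real (Suc n) * \<rho>"
      using hilbert_dist_nonneg[OF C inC] Suc.prems by (auto simp: D_def)
    have rn: "D = r * real (Suc n)" by (simp add: r_def)
    have r: "0 \<le> r" "r < \<rho>"
      using D by (auto simp: r_def pos_divide_less_eq mult.commute)
    have "r * 1 \<le> D" unfolding rn using r(1) by (intro mult_left_mono) auto
    then obtain z where z: "z \<in> C" "hilbert_dist C x z = r" "hilbert_dist C z y = D - r"
      using hilbert_dist_between[OF C inC r(1)] unfolding D_def by auto
    have "D - r = real n * r" unfolding rn by (simp add: algebra_simps)
    then have zy: "hilbert_dist C z y < real n * \<rho>" using z r False by simp
    obtain \<zeta> where zeta: "\<zeta> \<in> V" "z \<in> hilbert_ball C \<zeta> \<rho>" using cover z(1) by blast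
    obtain k where k: "k \<le> n" "(\<zeta>, \<eta>) \<in> E ^^ k"
      using Suc.IH[OF zeta(2) Suc.prems(2) zeta(1) Suc.prems(4) zy] by blast
    obtain j where j: "j \<le> 1" "(\<xi>, \<zeta>) \<in> E ^^ j" using step[OF zeta] z r by auto
    have "(\<xi>, \<eta>) \<in> E ^^ (j + k)" using j(2) k(2) by (auto simp: relpow_add)
    then show ?thesis using j(1) k(1) by (intro exI[of _ "j + k"]) auto
  qed
qed

section \<open>Coarse nets and quasi-isometries\<close>

text \<open>The common form of \<open>C\<close> itself and of its discretisations, so that a single
  lemma gives both claims. \<open>dV\<close> is a distance of its own on \<open>V\<close>, only
  comparable with \<open>d\<close>.\<close>

definition coarse_net :: "'a set \<Rightarrow> ('a \<Rightarrow> 'a \<Rightarrow> real) \<Rightarrow> 'a set \<Rightarrow> ('a \<Rightarrow> 'a \<Rightarrow> real) \<Rightarrow> bool" where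
  "coarse_net X d V dV \<longleftrightarrow> V \<subseteq> X \<and>
     (\<exists>K\<ge>1. (\<forall>x\<in>X. \<exists>v\<in>V. d v x \<le> K) \<and>
       (\<forall>v\<in>V. \<forall>w\<in>V. d v w \<le> K * dV v w \<and> dV v w \<le> K * d v w + K))"

lemma coarse_net_discretisation:
  fixes C :: "'a::euclidean_space set"
  assumes C: "hilbert_geometry C" and disc: "discretisation C V E"
  shows "coarse_net C (hilbert_dist C) V (graph_dist E)"
proof -
  obtain \<epsilon> \<rho> where *: "\<rho> > 0" "separated_in C \<epsilon> V" "C = (\<Union>\<xi>\<in>V. hilbert_ball C \<xi> \<rho>)"
    and E: "E = (SIGMA \<xi>:V. nbhs C V \<rho> \<xi>)"
    using disc unfolding discretisation_def by blast
  have V: "V \<subseteq> C" using *(2) by (simp add: separated_in_def)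
  have path: "\<exists>k. real k \<le> hilbert_dist C v w / \<rho> + 1 \<and> (v, w) \<in> E ^^ k"
    if "v \<in> V" "w \<in> V" for v w
  proof -
    \<comment> \<open>The \<open>+ 1\<close> makes the bound \<open>real n * \<rho>\<close> on the
      distance strict, and is the source of the additive constant in \<open>upper\<close>.\<close>
    define n where "n = nat \<lfloor>hilbert_dist C v w / \<rho>\<rfloor> + 1"
    have "0 \<le> hilbert_dist C v w / \<rho>"
      using hilbert_dist_nonneg[OF C subsetD[OF V that(1)] subsetD[OF V that(2)]] *(1) by simp
    then have n: "hilbert_dist C v w / \<rho> < real n" "real n \<le> hilbert_dist C v w / \<rho> + 1"
      unfolding n_def by linarith+
    then have "hilbert_dist C v w < real n * \<rho>" using *(1) by (simp add: field_simps)
    moreover have "v \<in> hilbert_ball C v \<rho>" "w \<in> hilbert_ball C w \<rho>"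
      using V that *(1) by (auto simp: hilbert_ball_def)
    ultimately have "\<exists>k\<le>n. (v, w) \<in> E ^^ k"
      using edge_path_exists[OF C V equalityD1[OF *(3)] E] that by blast
    then obtain k where "k \<le> n" "(v, w) \<in> E ^^ k" by blast
    then show ?thesis using n(2) by (intro exI[of _ k]) auto
  qed
  have upper: "graph_dist E v w \<le> hilbert_dist C v w / \<rho> + 1" if "v \<in> V" "w \<in> V" for v w
    using path[OF that] Least_le[of "\<lambda>k. (v, w) \<in> E ^^ k"]
    unfolding graph_dist_def by (meson of_nat_le_iff order_trans)
  have lower: "hilbert_dist C v w \<le> 3 * \<rho> * graph_dist E v w" if "v \<in> V" "w \<in> V" for v w
  proof -
    \<comment> \<open>By \<open>path\<close> some edge path exists, so the minimum in
      \<open>graph_dist\<close> is attained.\<close>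
    have "(v, w) \<in> E ^^ (LEAST k. (v, w) \<in> E ^^ k)"
      using path[OF that] by (metis LeastI)
    then show ?thesis
      using edge_path_hilbert_dist_le[OF C V E] that unfolding graph_dist_def by blast
  qed
  \<comment> \<open>A sum of positive terms, to dominate all the constants at once.\<close>
  define K where "K = 1 + 3 * \<rho> + 1 / \<rho>"
  have K: "1 \<le> K" "\<rho> \<le> K" "3 * \<rho> \<le> K" "1 / \<rho> \<le> K" using *(1) by (auto simp: K_def)
  have "\<exists>v\<in>V. hilbert_dist C v x \<le> K" if "x \<in> C" for x
  proof -
    obtain v where "v \<in> V" "x \<in> hilbert_ball C v \<rho>" using *(3) \<open>x \<in> C\<close> by blast
    then show ?thesis using K(2) by (intro bexI[of _ v]) (auto simp: hilbert_ball_def)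
  qed
  moreover have "hilbert_dist C v w \<le> K * graph_dist E v w \<and>
      graph_dist E v w \<le> K * hilbert_dist C v w + K" if "v \<in> V" "w \<in> V" for v w
  proof
    have "0 \<le> graph_dist E v w" by (simp add: graph_dist_def)
    then show "hilbert_dist C v w \<le> K * graph_dist E v w"
      using lower[OF that] mult_right_mono[OF K(3)] by fastforce
    have "0 \<le> hilbert_dist C v w" using hilbert_dist_nonneg[OF C, of v w] V that by auto
    then show "graph_dist E v w \<le> K * hilbert_dist C v w + K"
      using upper[OF that] K(1) mult_right_mono[OF K(4)] by fastforce
  qed
  ultimately show ?thesis unfolding coarse_net_def using V K(1) by blast
qed

lemma coarse_net_self:
  assumes "\<And>x. x \<in> X \<Longrightarrow> d x x = 0"
  shows "coarse_net X d X d"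
proof -
  have "\<exists>v\<in>X. d v x \<le> 1" if "x \<in> X" for x
    using assms(1)[OF that] that by (intro bexI[of _ x]) auto
  then show ?thesis unfolding coarse_net_def by (intro conjI exI[of _ 1]) auto
qed

text \<open>Move each point of \<open>V\<close> to a point of \<open>W\<close> within
  \<open>L\<close>. This changes \<open>d\<close> by at most \<open>2 * L\<close>, and the net
  inequalities translate between \<open>d\<close> and the two inner distances.\<close>

lemma quasi_isometric_coarse_nets:
  assumes sym: "\<And>x y. x \<in> X \<Longrightarrow> y \<in> X \<Longrightarrow> d x y = d y x"
    and triangle: "\<And>x y z. x \<in> X \<Longrightarrow> y \<in> X \<Longrightarrow> z \<in> X \<Longrightarrow> d x z \<le> d x y + d y z"
    and V: "coarse_net X d V dV" and W: "coarse_net X d W dW"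
  shows "quasi_isometric V dV W dW"
proof -
  from V obtain K where VX: "V \<subseteq> X" and K: "K \<ge> 1" "\<And>x. x \<in> X \<Longrightarrow> \<exists>v\<in>V. d v x \<le> K"
    "\<And>v w. v \<in> V \<Longrightarrow> w \<in> V \<Longrightarrow> d v w \<le> K * dV v w"
    "\<And>v w. v \<in> V \<Longrightarrow> w \<in> V \<Longrightarrow> dV v w \<le> K * d v w + K"
    unfolding coarse_net_def by blast
  from W obtain L where WX: "W \<subseteq> X" and L: "L \<ge> 1" "\<And>x. x \<in> X \<Longrightarrow> \<exists>w\<in>W. d w x \<le> L"
    "\<And>v w. v \<in> W \<Longrightarrow> w \<in> W \<Longrightarrow> d v w \<le> L * dW v w"
    "\<And>v w. v \<in> W \<Longrightarrow> w \<in> W \<Longrightarrow> dW v w \<le> L * d v w + L"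
    unfolding coarse_net_def by blast
  obtain f where f: "\<And>v. v \<in> V \<Longrightarrow> f v \<in> W" "\<And>v. v \<in> V \<Longrightarrow> d (f v) v \<le> L"
    using L(2) VX by (metis subsetD)
  \<comment> \<open>Passing from \<open>dV\<close> to \<open>d\<close> costs a factor
    \<open>K\<close>, from \<open>d\<close> to \<open>dW\<close> a factor \<open>L\<close>.
    \<open>B\<close> dominates the additive errors: \<open>2 * L * L + L\<close> above,
    \<open>2 + 1 / L\<close> below, and \<open>L * (K + L) + L\<close> for density.\<close>
  define A where "A = K * L"
  define B where "B = 2 * L * L + L + 1 + L * K"
  have A: "1 \<le> A" using mult_mono[OF K(1) L(1)] K(1) by (simp add: A_def)
  have LK: "0 \<le> L * L" "0 \<le> L * K" using K(1) L(1) by auto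
  have B: "0 \<le> B" using LK L(1) by (simp add: B_def)
  have lower: "1 / A * dV v v' - B \<le> dW (f v) (f v')" if v: "v \<in> V" "v' \<in> V" for v v'
  proof -
    have inX: "v \<in> X" "v' \<in> X" "f v \<in> X" "f v' \<in> X" using VX WX f v by auto
    have "d v v' \<le> d v (f v) + d (f v) (f v') + d (f v') v'"
      using triangle[of v "f v" v'] triangle[of "f v" "f v'" v'] inX by simp
    also have "\<dots> \<le> d (f v) (f v') + 2 * L"
      using f(2)[OF v(1)] f(2)[OF v(2)] sym[of v "f v"] inX by simp
    also have "\<dots> \<le> L * dW (f v) (f v') + 2 * L"
      using L(3) f v by simp
    finally have dvv: "d v v' \<le> L * dW (f v) (f v') + 2 * L" .
    have "dV v v' \<le> K * (L * dW (f v) (f v') + 2 * L) + K"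
      using K(4)[OF v] mult_left_mono[OF dvv order_trans[OF zero_le_one K(1)]] by linarith
    then have "dV v v' / A \<le> (K * (L * dW (f v) (f v') + 2 * L) + K) / A"
      using A by (simp add: divide_right_mono)
    also have "\<dots> = dW (f v) (f v') + 2 + 1 / L"
      using K(1) L(1) by (simp add: A_def field_simps)
    also have "\<dots> \<le> dW (f v) (f v') + B"
    proof -
      have "1 / L \<le> 1" "1 \<le> L * L" "1 \<le> L * K"
        using K(1) L(1) mult_mono[of 1 L 1 L] mult_mono[of 1 L 1 K] by auto
      then show ?thesis using L(1) unfolding B_def mult.assoc by linarith
    qed
    finally show ?thesis by simp
  qed
  have upper: "dW (f v) (f v') \<le> A * dV v v' + B" if v: "v \<in> V" "v' \<in> V" for v v'
  proof -
    have inX: "v \<in> X" "v' \<in> X" "f v \<in> X" "f v' \<in> X" using VX WX f v by auto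
    have "d (f v) (f v') \<le> d (f v) v + d v v' + d v' (f v')"
      using triangle[of "f v" v "f v'"] triangle[of v v' "f v'"] inX by simp
    also have "\<dots> \<le> K * dV v v' + 2 * L"
      using f(2)[OF v(1)] f(2)[OF v(2)] sym[of v' "f v'"] inX K(3)[OF v] by simp
    finally have *: "d (f v) (f v') \<le> K * dV v v' + 2 * L" .
    have "dW (f v) (f v') \<le> L * (K * dV v v' + 2 * L) + L"
      using L(4)[OF f(1)[OF v(1)] f(1)[OF v(2)]] mult_left_mono[OF * order_trans[OF zero_le_one L(1)]]
      by linarith
    then show ?thesis using LK by (simp add: A_def B_def algebra_simps)
  qed
  have dense: "\<exists>v\<in>V. dW w (f v) \<le> B" if w: "w \<in> W" for w
  proof -
    obtain v where v: "v \<in> V" "d v w \<le> K" using K(2) w WX by blast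
    have inX: "v \<in> X" "w \<in> X" "f v \<in> X" using VX WX f v w by auto
    have *: "d w (f v) \<le> K + L"
      using triangle[of w v "f v"] sym[of w v] sym[of v "f v"] inX v f(2)[OF v(1)] by simp
    then have "dW w (f v) \<le> L * (K + L) + L"
      using L(4)[OF w f(1)[OF v(1)]] mult_left_mono[OF * order_trans[OF zero_le_one L(1)]] by linarith
    also have "\<dots> \<le> B" using LK by (simp add: B_def algebra_simps)
    finally show ?thesis using v by blast
  qed
  show ?thesis
    unfolding quasi_isometric_def
    using f(1) A B lower upper dense by (intro bexI[of _ f] exI[of _ A] exI[of _ B] conjI) auto
qed

theorem theorem1:
  fixes C :: "(real ^ 'n) set"
  assumes "hilbert_geometry C"
  shows "(\<forall>V E. discretisation C V E \<longrightarrow>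
            quasi_isometric C (hilbert_dist C) V (graph_dist E)) \<and>
         (\<forall>V E V' E'. discretisation C V E \<and> discretisation C V' E' \<longrightarrow>
            quasi_isometric V (graph_dist E) V' (graph_dist E'))"
proof -
  note qi = quasi_isometric_coarse_nets[where X = C and d = "hilbert_dist C",
      OF hilbert_dist_sym[OF assms] hilbert_dist_triangle[OF assms]]
  note net = coarse_net_discretisation[OF assms]
  \<comment> \<open>With \<open>C\<close> as a net in itself, the first claim compares two nets just
    as the second does.\<close>
  have "coarse_net C (hilbert_dist C) C (hilbert_dist C)"
    by (rule coarse_net_self) simp
  then show ?thesis using qi net by blast
qed

end
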